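(* Let $M$ be a cancellative commutative (additive) monoid that is reduced and torsion-free. Then the following conditions are equivalent. (a) $M$ satisfies the ascending chain condition on principal ideals (ACCP). (b) $M$ is hereditarily atomic, that is, every submonoid of $M$ is atomic.
   Context: All monoids are cancellative and commutative, written additively with identity $0$. For a monoid $M$, $\mathcal{U}(M)$ denotes its group of invertible elements; $M$ is reduced if $\mathcal{U}(M)=\{0\}$. The difference group $\mathrm{gp}(M)$ is the Grothendieck group of $M$ (the abelian group of differences of elements of $M$); $M$ is torsion-free if $\mathrm{gp}(M)$ is a torsion-free abelian group. A non-invertible element $a \in M$ is an atom of $M$ if whenever $a=b+c$ with $b,c\in M$, either $b\in\mathcal{U}(M)$ or $c\in\mathcal{U}(M)$. An element of $M$ is atomic if it is invertible or is a sum of finitely many atoms of $M$; $M$ is atomic if every element of $M$ is atomic. A submonoid is regarded as a monoid in its own right when speaking of its atoms and atomicity. A principal ideal of $M$ is a set $b+M=\{b+c \mid c\in M\}$ with $b \in M$. $M$ satisfies the ACCP if for every sequence $(b_n)_{n\in\mathbb{N}}$ in $M$ with $b_n+M\subseteq b_{n+1}+M$ for all $n$, there is $n_0 \in \mathbb{N}$ with $b_n+M=b_{n+1}+M$ for all $n\ge n_0$. *)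

theory Defs
  imports "HOL-Algebra.Divisibility"
begin

text \<open>
  Monoids are HOL-Algebra structures, written multiplicatively: the additive \<open>b + c\<close>, \<open>0\<close> and
  \<open>n\<cdot>x\<close> become \<open>b \<otimes> c\<close>, \<open>\<one>\<close> and \<open>x [^] n\<close>. The group \<open>\<U>(M)\<close> of invertible elements is
  \<^term>\<open>Units M\<close>, and a submonoid \<open>H\<close>, seen as a monoid in its own right, is
  \<^term>\<open>M\<lparr>carrier := H\<rparr>\<close>.
\<close>

definition reduced_monoid :: "('a, 'b) monoid_scheme \<Rightarrow> bool" where
  "reduced_monoid M \<longleftrightarrow> Units M = {\<one>\<^bsub>M\<^esub>}"

text \<open>The pair \<open>(a, b)\<close> represents the formal difference \<open>a - b\<close>. For cancellative \<open>M\<close> the relation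
  below is an equivalence, with no auxiliary summand needed on the two sides.\<close>

definition diff_rel :: "('a, 'b) monoid_scheme \<Rightarrow> (('a \<times> 'a) \<times> ('a \<times> 'a)) set" where
  "diff_rel M = {((a, b), (c, d)). a \<in> carrier M \<and> b \<in> carrier M \<and> c \<in> carrier M \<and> d \<in> carrier M
     \<and> a \<otimes>\<^bsub>M\<^esub> d = c \<otimes>\<^bsub>M\<^esub> b}"

definition diff_group :: "('a, 'b) monoid_scheme \<Rightarrow> ('a \<times> 'a) set monoid" where
  "diff_group M = \<lparr>
     carrier = (carrier M \<times> carrier M) // diff_rel M,
     mult = (\<lambda>X Y. \<Union>(a, b)\<in>X. \<Union>(c, d)\<in>Y. diff_rel M `` {(a \<otimes>\<^bsub>M\<^esub> c, b \<otimes>\<^bsub>M\<^esub> d)}),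
     one = diff_rel M `` {(\<one>\<^bsub>M\<^esub>, \<one>\<^bsub>M\<^esub>)}\<rparr>"

definition torsion_free_group :: "('a, 'b) monoid_scheme \<Rightarrow> bool" where
  "torsion_free_group G \<longleftrightarrow>
     (\<forall>x \<in> carrier G. \<forall>n::nat. n > 0 \<longrightarrow> x [^]\<^bsub>G\<^esub> n = \<one>\<^bsub>G\<^esub> \<longrightarrow> x = \<one>\<^bsub>G\<^esub>)"

definition torsion_free_monoid :: "('a, 'b) monoid_scheme \<Rightarrow> bool" where
  "torsion_free_monoid M \<longleftrightarrow> torsion_free_group (diff_group M)"

definition atom :: "('a, 'b) monoid_scheme \<Rightarrow> 'a \<Rightarrow> bool" where
  "atom M a \<longleftrightarrow> a \<in> carrier M \<and> a \<notin> Units M \<and>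
     (\<forall>b \<in> carrier M. \<forall>c \<in> carrier M. a = b \<otimes>\<^bsub>M\<^esub> c \<longrightarrow> b \<in> Units M \<or> c \<in> Units M)"

definition atomic_element :: "('a, 'b) monoid_scheme \<Rightarrow> 'a \<Rightarrow> bool" where
  "atomic_element M x \<longleftrightarrow> x \<in> Units M \<or>
     (\<exists>as. (\<forall>a \<in> set as. atom M a) \<and> x = foldr (\<otimes>\<^bsub>M\<^esub>) as \<one>\<^bsub>M\<^esub>)"

definition atomic_monoid :: "('a, 'b) monoid_scheme \<Rightarrow> bool" where
  "atomic_monoid M \<longleftrightarrow> (\<forall>x \<in> carrier M. atomic_element M x)"

definition hereditarily_atomic :: "('a, 'b) monoid_scheme \<Rightarrow> bool" where
  "hereditarily_atomic M \<longleftrightarrow> (\<forall>H. submonoid H M \<longrightarrow> atomic_monoid (M\<lparr>carrier := H\<rparr>))"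

definition principal_ideal_of :: "('a, 'b) monoid_scheme \<Rightarrow> 'a \<Rightarrow> 'a set" where
  "principal_ideal_of M b = {b \<otimes>\<^bsub>M\<^esub> c | c. c \<in> carrier M}"

definition ACCP :: "('a, 'b) monoid_scheme \<Rightarrow> bool" where
  "ACCP M \<longleftrightarrow> (\<forall>b :: nat \<Rightarrow> 'a.
     (\<forall>n. b n \<in> carrier M) \<and> (\<forall>n. principal_ideal_of M (b n) \<subseteq> principal_ideal_of M (b (Suc n)))
     \<longrightarrow> (\<exists>n0. \<forall>n \<ge> n0. principal_ideal_of M (b n) = principal_ideal_of M (b (Suc n))))"

context comm_monoid_cancel
begin

lemma equiv_diff_rel: "equiv (carrier G \<times> carrier G) (diff_rel G)"
proof (rule equivI)
  show "trans (diff_rel G)"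
  proof (rule transI)
    fix x y z assume xy: "(x, y) \<in> diff_rel G" and yz: "(y, z) \<in> diff_rel G"
    obtain a b c d e f where eq: "x = (a, b)" "y = (c, d)" "z = (e, f)"
      by (metis surj_pair)
    have cl: "a \<in> carrier G" "b \<in> carrier G" "c \<in> carrier G" "d \<in> carrier G"
        "e \<in> carrier G" "f \<in> carrier G"
      and 1: "a \<otimes> d = c \<otimes> b" and 2: "c \<otimes> f = e \<otimes> d"
      using xy yz by (auto simp: diff_rel_def eq)
    have "(a \<otimes> f) \<otimes> d = (a \<otimes> d) \<otimes> f"
      using cl by (simp add: m_ac)
    also have "\<dots> = (c \<otimes> f) \<otimes> b"
      unfolding 1 using cl by (simp add: m_ac)
    also have "\<dots> = (e \<otimes> b) \<otimes> d"
      unfolding 2 using cl by (simp add: m_ac)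
    finally have "a \<otimes> f = e \<otimes> b"
      using cl by (meson m_closed r_cancel)
    thus "(x, z) \<in> diff_rel G"
      using cl by (simp add: diff_rel_def eq)
  qed
qed (auto simp: diff_rel_def refl_on_def sym_def)

lemma diff_class_eq_iff:
  assumes "a \<in> carrier G" "b \<in> carrier G" "c \<in> carrier G" "d \<in> carrier G"
  shows "diff_rel G `` {(a, b)} = diff_rel G `` {(c, d)} \<longleftrightarrow> a \<otimes> d = c \<otimes> b"
  using assms by (subst eq_equiv_class_iff[OF equiv_diff_rel]) (auto simp: diff_rel_def)

lemma diff_group_mult:
  assumes "a \<in> carrier G" "b \<in> carrier G" "c \<in> carrier G" "d \<in> carrier G"
  shows "diff_rel G `` {(a, b)} \<otimes>\<^bsub>diff_group G\<^esub> diff_rel G `` {(c, d)} =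
         diff_rel G `` {(a \<otimes> c, b \<otimes> d)}"
proof -
  have key: "diff_rel G `` {(a' \<otimes> c', b' \<otimes> d')} = diff_rel G `` {(a \<otimes> c, b \<otimes> d)}"
    if "((a, b), (a', b')) \<in> diff_rel G" "((c, d), (c', d')) \<in> diff_rel G" for a' b' c' d'
  proof -
    have cl: "a' \<in> carrier G" "b' \<in> carrier G" "c' \<in> carrier G" "d' \<in> carrier G"
      and 1: "a \<otimes> b' = a' \<otimes> b" and 2: "c \<otimes> d' = c' \<otimes> d"
      using that by (auto simp: diff_rel_def)
    have "(a' \<otimes> c') \<otimes> (b \<otimes> d) = (a' \<otimes> b) \<otimes> (c' \<otimes> d)"
      using cl assms by (simp add: m_ac)
    also have "\<dots> = (a \<otimes> c) \<otimes> (b' \<otimes> d')"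
      unfolding 1[symmetric] 2[symmetric] using cl assms by (simp add: m_ac)
    finally show ?thesis
      using cl assms by (simp add: diff_class_eq_iff)
  qed
  have "((a, b), (a, b)) \<in> diff_rel G" "((c, d), (c, d)) \<in> diff_rel G"
    using assms by (auto simp: diff_rel_def)
  hence "(\<Union>(a', b')\<in>diff_rel G `` {(a, b)}. \<Union>(c', d')\<in>diff_rel G `` {(c, d)}.
            diff_rel G `` {(a' \<otimes> c', b' \<otimes> d')}) = diff_rel G `` {(a \<otimes> c, b \<otimes> d)}"
    using key by (intro equalityI subsetI) (fastforce, blast)
  thus ?thesis
    by (simp add: diff_group_def)
qed

lemma diff_group_carrierE:
  assumes "X \<in> carrier (diff_group G)"
  obtains a b where "a \<in> carrier G" "b \<in> carrier G" "X = diff_rel G `` {(a, b)}"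
  using assms by (auto simp: diff_group_def elim!: quotientE)

lemma diff_group_carrierI:
  "a \<in> carrier G \<Longrightarrow> b \<in> carrier G \<Longrightarrow> diff_rel G `` {(a, b)} \<in> carrier (diff_group G)"
  by (auto simp: diff_group_def intro: quotientI)

lemma diff_group_one: "\<one>\<^bsub>diff_group G\<^esub> = diff_rel G `` {(\<one>, \<one>)}"
  by (simp add: diff_group_def)

lemma comm_group_diff_group: "comm_group (diff_group G)"
proof (rule comm_groupI)
  fix X assume "X \<in> carrier (diff_group G)"
  then obtain a b where "a \<in> carrier G" "b \<in> carrier G" "X = diff_rel G `` {(a, b)}"
    by (rule diff_group_carrierE)
  thus "\<exists>Y\<in>carrier (diff_group G). Y \<otimes>\<^bsub>diff_group G\<^esub> X = \<one>\<^bsub>diff_group G\<^esub>"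
    by (intro bexI[of _ "diff_rel G `` {(b, a)}"])
      (simp_all add: diff_group_mult diff_group_one diff_class_eq_iff diff_group_carrierI m_comm)
qed (auto elim!: diff_group_carrierE
       simp: diff_group_mult diff_group_one diff_group_carrierI m_ac)

end

end

theory Submission
  imports Defs "HOL-Algebra.FiniteProduct" "HOL-Library.Disjoint_Sets" "HOL-Library.Infinite_Set" "HOL-Number_Theory.Cong"
begin

text \<open>
  The chain condition passes to submonoids because the only invertible element is \<open>\<one>\<close>: a chain in
  a submonoid that stabilises in \<open>M\<close> does so with trivial quotients. Splitting non-atomic elements
  repeatedly would contradict this (\<open>ACCP_imp_hereditarily_atomic\<close>).

  For the converse, a chain that does not stabilise yields an element \<open>x\<close> and non-trivial elements
  \<open>c 0, c 1, \<dots>\<close> such that every finite product of distinctly indexed \<open>c i\<close> divides \<open>x\<close>. This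
  property survives passing to subsequences, grouping the \<open>c i\<close> into disjoint blocks, and
  multiplying \<open>x\<close> by any element. The submonoid generated by the \<open>c i\<close> and by the successive
  cofactors of their products in \<open>x\<close> is atomic only if \<open>x\<close> is itself a product of the \<open>c i\<close>
  (\<open>bounded_products_imp_mem_span\<close>). Hence the same must hold after each of these modifications,
  and this is far too much to ask.

  First, it forces infinitely many of the \<open>c j\<close> to have a common power \<open>c j [^] k j = y \<noteq> \<one>\<close>:
  otherwise a subsequence can be chosen greedily so that no product of its members equals \<open>x\<close>
  (\<open>exists_common_power\<close>). Written additively, these \<open>c j\<close> are the fractions \<open>y / k j\<close>. If each of
  the occurring \<open>k j\<close> properly divides another one, then each of these \<open>c j\<close> is a proper power of
  another by torsion-freeness, and together they generate a submonoid without atoms. Otherwise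
  some \<open>n\<close> among the \<open>k j\<close> has no proper multiple among them, and infinitely many of the \<open>k j\<close>
  share the same \<open>d = gcd (k j) n < n\<close>. With \<open>q = n / d > 1\<close>, the numbers \<open>k j / d\<close> are coprime
  to \<open>q\<close>, and infinitely many are congruent modulo \<open>q\<close>. Products of \<open>q\<close> of the corresponding
  \<open>c j\<close> then lie in the submonoid of the fractions \<open>q t y / (d U)\<close> with \<open>U\<close> coprime to \<open>q\<close>.
  Grouping into such blocks puts both \<open>x\<close> and \<open>x \<otimes> c j\<close> into this submonoid, which is impossible
  since \<open>c j\<close> has a numerator prime to \<open>q\<close> (\<open>no_coprime_roots\<close>).
\<close>

section \<open>Torsion-freeness\<close>

lemma (in comm_monoid_cancel) diff_group_pow:
  assumes "a \<in> carrier G" "b \<in> carrier G"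
  shows "(diff_rel G `` {(a, b)}) [^]\<^bsub>diff_group G\<^esub> (n::nat) = diff_rel G `` {(a [^] n, b [^] n)}"
  using assms by (induction n) (simp_all add: diff_group_one diff_group_mult)

lemma (in comm_monoid_cancel) torsion_free_pow_inject:
  assumes "torsion_free_monoid G" "a \<in> carrier G" "b \<in> carrier G"
    and "(n::nat) > 0" "a [^] n = b [^] n"
  shows "a = b"
proof -
  have "(diff_rel G `` {(a, b)}) [^]\<^bsub>diff_group G\<^esub> n = \<one>\<^bsub>diff_group G\<^esub>"
    using assms by (simp add: diff_group_pow diff_group_one diff_class_eq_iff)
  hence "diff_rel G `` {(a, b)} = \<one>\<^bsub>diff_group G\<^esub>"
    using assms(1,4) diff_group_carrierI[OF assms(2,3)]
    by (auto simp: torsion_free_monoid_def torsion_free_group_def)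
  thus ?thesis
    using assms by (simp add: diff_group_one diff_class_eq_iff)
qed

section \<open>Generated submonoids and their atoms\<close>

text \<open>The inductive rules mirror the right-nested products of lists that define atomic elements, so
  an element is atomic exactly when it lies in the span of the atoms.\<close>

inductive_set submonoid_span :: "('a, 'b) monoid_scheme \<Rightarrow> 'a set \<Rightarrow> 'a set"
  for G (structure) and A where
  one: "\<one> \<in> submonoid_span G A"
| mult: "a \<in> A \<Longrightarrow> x \<in> submonoid_span G A \<Longrightarrow> a \<otimes> x \<in> submonoid_span G A"

lemma submonoid_span_mono:
  "x \<in> submonoid_span G A \<Longrightarrow> A \<subseteq> B \<Longrightarrow> x \<in> submonoid_span G B"
  by (induction rule: submonoid_span.induct) (auto intro: submonoid_span.intros)

lemma mem_submonoid_span_iff_foldr: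
  "x \<in> submonoid_span G A \<longleftrightarrow> (\<exists>as. set as \<subseteq> A \<and> x = foldr (\<otimes>\<^bsub>G\<^esub>) as \<one>\<^bsub>G\<^esub>)"
proof
  assume "x \<in> submonoid_span G A"
  thus "\<exists>as. set as \<subseteq> A \<and> x = foldr (\<otimes>\<^bsub>G\<^esub>) as \<one>\<^bsub>G\<^esub>"
  proof induction
    case one
    show ?case by (intro exI[of _ "[]"]) simp
  next
    case (mult a x)
    then obtain as where "set as \<subseteq> A" "x = foldr (\<otimes>\<^bsub>G\<^esub>) as \<one>\<^bsub>G\<^esub>" by blast
    with mult show ?case by (intro exI[of _ "a # as"]) simp
  qed
next
  have "set as \<subseteq> A \<Longrightarrow> foldr (\<otimes>\<^bsub>G\<^esub>) as \<one>\<^bsub>G\<^esub> \<in> submonoid_span G A" for as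
    by (induction as) (auto intro: submonoid_span.intros)
  thus "\<exists>as. set as \<subseteq> A \<and> x = foldr (\<otimes>\<^bsub>G\<^esub>) as \<one>\<^bsub>G\<^esub> \<Longrightarrow> x \<in> submonoid_span G A"
    by blast
qed

context comm_monoid
begin

lemma submonoid_span_carrier:
  assumes "A \<subseteq> carrier G" "x \<in> submonoid_span G A"
  shows "x \<in> carrier G"
  using assms(2,1) by induction auto

lemma submonoid_span_mult_closed:
  assumes "A \<subseteq> carrier G" "x \<in> submonoid_span G A" "y \<in> submonoid_span G A"
  shows "x \<otimes> y \<in> submonoid_span G A"
  using assms(2)
proof induction
  case one
  thus ?case using assms submonoid_span_carrier by simp
next
  case (mult a x)
  hence "a \<otimes> x \<otimes> y = a \<otimes> (x \<otimes> y)"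
    using assms submonoid_span_carrier by (meson m_assoc subsetD)
  thus ?case using mult by (auto intro: submonoid_span.mult)
qed

lemma submonoid_span_base:
  assumes "A \<subseteq> carrier G" "a \<in> A"
  shows "a \<in> submonoid_span G A"
  using submonoid_span.mult[OF assms(2) submonoid_span.one[of G A]] assms by auto

lemma submonoid_submonoid_span: "A \<subseteq> carrier G \<Longrightarrow> submonoid (submonoid_span G A) G"
  by (intro submonoid.intro)
    (auto intro: submonoid_span_carrier submonoid_span_mult_closed submonoid_span.one)

lemma submonoid_span_subset:
  assumes "x \<in> submonoid_span G A" "submonoid H G" "A \<subseteq> H"
  shows "x \<in> H"
  using assms by induction (auto intro: submonoid.m_closed submonoid.one_closed)

lemma finprod_mem_submonoid:
  assumes H: "submonoid H G" and "\<And>i. i \<in> F \<Longrightarrow> f i \<in> H"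
  shows "finprod G f F \<in> H"
  using assms(2)
proof (induction F rule: infinite_finite_induct)
  case (insert i F)
  have "f j \<in> carrier G" if "j \<in> insert i F" for j
    using insert.prems[OF that] submonoid.subset[OF H] by blast
  thus ?case
    using insert submonoid.m_closed[OF H] by (subst finprod_insert) auto
qed (auto intro: submonoid.one_closed[OF H])

lemma submonoid_span_insert_decompose:
  assumes "w \<in> submonoid_span G (insert a A)" "a \<in> carrier G" "A \<subseteq> carrier G"
  shows "\<exists>(k::nat). \<exists>w' \<in> submonoid_span G A. w = a [^] k \<otimes> w'"
  using assms(1)
proof induction
  case one
  show ?case by (intro exI[of _ 0] bexI[of _ "\<one>"]) (auto intro: submonoid_span.one)
next
  case (mult g x)
  then obtain k w' where w': "w' \<in> submonoid_span G A" "x = a [^] (k::nat) \<otimes> w'" by blast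
  have car: "w' \<in> carrier G" "g \<in> carrier G"
    using w' assms mult.hyps submonoid_span_carrier by auto
  show ?case
  proof (cases "g = a")
    case True
    have "g \<otimes> x = a [^] Suc k \<otimes> w'"
      using car assms by (simp add: True w' m_ac)
    thus ?thesis using w' by blast
  next
    case False
    have "g \<otimes> x = a [^] k \<otimes> (g \<otimes> w')"
      using car assms by (simp add: w' m_ac)
    thus ?thesis using w' mult.hyps False by (auto intro: submonoid_span.mult)
  qed
qed

end

locale reduced_cancel_monoid = comm_monoid_cancel +
  assumes reduced: "reduced_monoid G"
begin

lemma mult_eq_one_imp:
  assumes "a \<in> carrier G" "b \<in> carrier G" "a \<otimes> b = \<one>"
  shows "a = \<one>" "b = \<one>"
proof -
  have "a \<in> Units G" "b \<in> Units G"
    using assms m_comm[OF assms(1,2)] by (auto simp: Units_def)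
  thus "a = \<one>" "b = \<one>"
    using reduced by (auto simp: reduced_monoid_def)
qed

lemma mult_eq_left_imp:
  assumes "a \<in> carrier G" "b \<in> carrier G" "a \<otimes> b = a"
  shows "b = \<one>"
  using assms by (metis l_cancel one_closed r_one)

lemma pow_eq_one_imp:
  assumes "a \<in> carrier G" "a [^] (n::nat) = \<one>" "n > 0"
  shows "a = \<one>"
  using assms mult_eq_one_imp(2)[of "a [^] (n - 1)" a] by (cases n) auto

lemma pow_inject_exp:
  assumes "a \<in> carrier G" "a \<noteq> \<one>" "a [^] (m::nat) = a [^] (n::nat)"
  shows "m = n"
proof -
  have *: "m = n" if "m \<le> n" "a [^] m = a [^] n" for m n :: nat
  proof -
    have "a [^] m \<otimes> a [^] (n - m) = a [^] m"
      using that nat_pow_mult[OF assms(1), of m "n - m"] by simp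
    hence "a [^] (n - m) = \<one>"
      using assms(1) by (intro mult_eq_left_imp) auto
    thus ?thesis
      using pow_eq_one_imp[OF assms(1), of "n - m"] assms(2) that(1) by (cases "n - m = 0") auto
  qed
  show ?thesis
    using *[of m n] *[of n m] assms(3) by (cases "m \<le> n") auto
qed

lemma Units_submonoid:
  assumes "submonoid H G"
  shows "Units (G\<lparr>carrier := H\<rparr>) = {\<one>}"
  using submonoid.subset[OF assms] submonoid.one_closed[OF assms]
  by (auto simp: Units_def dest: mult_eq_one_imp intro!: bexI[of _ "\<one>"])

lemma atom_submonoid_iff:
  assumes "submonoid H G"
  shows "atom (G\<lparr>carrier := H\<rparr>) a \<longleftrightarrow>
    a \<in> H \<and> a \<noteq> \<one> \<and> (\<forall>b\<in>H. \<forall>c\<in>H. a = b \<otimes> c \<longrightarrow> b = \<one> \<or> c = \<one>)"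
  by (simp add: atom_def Units_submonoid[OF assms])

lemma atomic_element_submonoid_iff:
  assumes "submonoid H G"
  shows "atomic_element (G\<lparr>carrier := H\<rparr>) x \<longleftrightarrow>
    x \<in> submonoid_span G {a. atom (G\<lparr>carrier := H\<rparr>) a}"
  by (auto simp: atomic_element_def Units_submonoid[OF assms] mem_submonoid_span_iff_foldr
      subset_iff intro: exI[of _ "[]"])

text \<open>Splitting off trivial factors, a product of generators is either one of them or a product
  of two non-trivial elements of the span.\<close>

lemma atom_submonoid_span_mem_generators:
  assumes A: "A \<subseteq> carrier G" and a: "atom (G\<lparr>carrier := submonoid_span G A\<rparr>) a"
  shows "a \<in> A"
proof -
  note H = submonoid_submonoid_span[OF A]
  have "a \<in> submonoid_span G A" using a by (simp add: atom_submonoid_iff[OF H])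
  thus ?thesis using a
  proof induction
    case one
    thus ?case by (simp add: atom_submonoid_iff[OF H])
  next
    case (mult g x)
    have car: "g \<in> carrier G" "x \<in> carrier G"
      using mult.hyps A submonoid_span_carrier by auto
    have "g = \<one> \<or> x = \<one>"
      using mult.prems mult.hyps submonoid_span_base[OF A mult.hyps(1)]
      by (auto simp: atom_submonoid_iff[OF H])
    thus ?case
      using mult car by auto
  qed
qed

end

section \<open>The chain condition implies hereditary atomicity\<close>

text \<open>A non-atomic element of a submonoid factors non-trivially with a non-atomic factor. Repeating
  this gives a chain of principal ideals of the whole monoid, and where it stabilises the
  complementary factor is invertible, hence trivial.\<close>

lemma (in reduced_cancel_monoid) ACCP_imp_hereditarily_atomic:
  assumes "ACCP G"
  shows "hereditarily_atomic G"
  unfolding hereditarily_atomic_def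
proof (intro allI impI)
  fix H assume H: "submonoid H G"
  note HG = submonoid.subset[OF H]
  define S where "S = submonoid_span G {a. atom (G\<lparr>carrier := H\<rparr>) a}"
  have atoms: "{a. atom (G\<lparr>carrier := H\<rparr>) a} \<subseteq> carrier G"
    using HG by (auto simp: atom_submonoid_iff[OF H])
  have split: "\<exists>y. (y \<in> H \<and> y \<notin> S) \<and> (\<exists>c\<in>H. c \<noteq> \<one> \<and> x = y \<otimes> c)"
    if x: "x \<in> H \<and> x \<notin> S" for x
  proof -
    have "x \<noteq> \<one>" using x by (auto simp: S_def intro: submonoid_span.one)
    moreover have "\<not> atom (G\<lparr>carrier := H\<rparr>) x"
      using x submonoid_span_base[OF atoms] by (auto simp: S_def)
    ultimately obtain b c where bc: "b \<in> H" "c \<in> H" "x = b \<otimes> c" "b \<noteq> \<one>" "c \<noteq> \<one>"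
      using x by (auto simp: atom_submonoid_iff[OF H])
    have comm: "x = c \<otimes> b" using bc HG m_comm by auto
    have "b \<notin> S \<or> c \<notin> S"
      using x bc(3) submonoid_span_mult_closed[OF atoms] by (auto simp: S_def)
    thus ?thesis using bc comm by blast
  qed
  have "x \<in> S" if "x \<in> H" for x
  proof (rule ccontr)
    assume "x \<notin> S"
    hence "\<exists>f. \<forall>n. (f n \<in> H \<and> f n \<notin> S) \<and> (\<exists>c\<in>H. c \<noteq> \<one> \<and> f n = f (Suc n) \<otimes> c)"
      using that split by (intro dependent_nat_choice) blast+
    then obtain f where f: "\<And>n. f n \<in> H" and "\<And>n. \<exists>c\<in>H. c \<noteq> \<one> \<and> f n = f (Suc n) \<otimes> c"
      by blast
    then obtain c where c: "\<And>n. c n \<in> H" "\<And>n. c n \<noteq> \<one>" "\<And>n. f n = f (Suc n) \<otimes> c n"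
      by metis
    have car: "f n \<in> carrier G" "c n \<in> carrier G" for n
      using f c(1) HG by auto
    have "principal_ideal_of G (f n) \<subseteq> principal_ideal_of G (f (Suc n))" for n
    proof
      fix z assume "z \<in> principal_ideal_of G (f n)"
      then obtain d where d: "d \<in> carrier G" "z = f n \<otimes> d" by (auto simp: principal_ideal_of_def)
      hence "z = f (Suc n) \<otimes> (c n \<otimes> d)" using car d by (simp add: c(3)[of n] m_assoc)
      thus "z \<in> principal_ideal_of G (f (Suc n))"
        using d car by (auto simp: principal_ideal_of_def)
    qed
    then obtain n where n: "principal_ideal_of G (f n) = principal_ideal_of G (f (Suc n))"
      using assms[unfolded ACCP_def, rule_format, of f] car(1) by auto
    have "f (Suc n) \<in> principal_ideal_of G (f (Suc n))"
      using car by (auto simp: principal_ideal_of_def intro!: exI[of _ "\<one>"])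
    then obtain d where d: "d \<in> carrier G" "f (Suc n) = f n \<otimes> d"
      unfolding n[symmetric] by (auto simp: principal_ideal_of_def)
    hence "f (Suc n) \<otimes> (c n \<otimes> d) = f (Suc n)"
      using c(3)[of n] car m_assoc[of "f (Suc n)" "c n" d] by simp
    hence "c n \<otimes> d = \<one>" using mult_eq_left_imp[of "f (Suc n)" "c n \<otimes> d"] car d by simp
    thus False using mult_eq_one_imp(1)[of "c n" d] car d c(2) by simp
  qed
  thus "atomic_monoid (G\<lparr>carrier := H\<rparr>)"
    by (simp add: atomic_monoid_def atomic_element_submonoid_iff[OF H] S_def)
qed

section \<open>Elements bounding infinitely many factors\<close>

context reduced_cancel_monoid
begin

text \<open>This is the trace left by a chain of principal ideals that does not stabilise. Quantifying
  over all finite index sets, and not only over initial segments, gives stability under the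
  passage to subsequences and blocks.\<close>

definition bounds_products :: "'a \<Rightarrow> (nat \<Rightarrow> 'a) \<Rightarrow> bool" where
  "bounds_products x c \<longleftrightarrow> (\<forall>F. finite F \<longrightarrow> finprod G c F divides x)"

lemma bounds_products_mult:
  assumes "bounds_products x c" "x \<in> carrier G" "y \<in> carrier G" "range c \<subseteq> carrier G"
  shows "bounds_products (x \<otimes> y) c"
proof -
  have "finprod G c F \<in> carrier G" for F using assms(4) by (intro finprod_closed) auto
  thus ?thesis using assms unfolding bounds_products_def by (blast intro: divides_prod_r)
qed

lemma bounds_products_blocks:
  assumes "bounds_products x c" "range c \<subseteq> carrier G" "\<And>i. finite (B i)" "disjoint_family B"
  shows "bounds_products x (\<lambda>i. finprod G c (B i))"
  unfolding bounds_products_def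
proof (intro allI impI)
  fix F :: "nat set" assume F: "finite F"
  have "finprod G (\<lambda>i. finprod G c (B i)) F = finprod G c (\<Union>(B ` F))"
    using F assms(2-4)
    by (intro finprod_UN_disjoint[symmetric]) (auto simp: pairwise_def disjoint_family_on_def disjnt_def)
  thus "finprod G (\<lambda>i. finprod G c (B i)) F divides x"
    using assms(1,3) F by (simp add: bounds_products_def)
qed

lemma bounds_products_subsequence:
  assumes "bounds_products x c" "range c \<subseteq> carrier G" "inj f"
  shows "bounds_products x (c \<circ> f)"
proof -
  have "bounds_products x (\<lambda>i. finprod G c {f i})"
    using assms by (intro bounds_products_blocks) (auto simp: disjoint_family_on_def inj_def)
  moreover have "finprod G c {f i} = c (f i)" for i
    using assms(2) finprod_insert[of "{}" "f i" c] by (auto simp: subset_iff)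
  ultimately show ?thesis by (simp add: comp_def)
qed

lemma finprod_eq_one_imp:
  assumes "finprod G c F = \<one>" "finite F" "j \<in> F" "range c \<subseteq> carrier G"
  shows "c j = \<one>"
proof -
  have cl: "c i \<in> carrier G" for i using assms(4) by auto
  have "finprod G c F = c j \<otimes> finprod G c (F - {j})"
    using assms(2,3) cl finprod_insert[of "F - {j}" j c] by (simp add: insert_absorb)
  thus ?thesis using mult_eq_one_imp(1)[of "c j" "finprod G c (F - {j})"] assms(1) cl by simp
qed

text \<open>Let \<open>r n\<close> be the cofactor of \<open>c 0 \<otimes> \<dots> \<otimes> c (n - 1)\<close> in \<open>x\<close>. In the submonoid generated by
  all \<open>c n\<close> and \<open>r n\<close>, the relation \<open>r n = c n \<otimes> r (n + 1)\<close> keeps every \<open>r n\<close> from being an atom,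
  so the atoms are among the \<open>c n\<close>; atomicity then makes \<open>x = r 0\<close> a product of such elements.\<close>

lemma bounded_products_imp_mem_span:
  assumes her: "hereditarily_atomic G" and c: "range c \<subseteq> carrier G" "\<And>i. c i \<noteq> \<one>"
    and x: "x \<in> carrier G" "bounds_products x c"
  shows "x \<in> submonoid_span G (range c)"
proof (rule ccontr)
  assume not: "x \<notin> submonoid_span G (range c)"
  have cl: "c i \<in> carrier G" for i using c by auto
  have "\<exists>r. r \<in> carrier G \<and> x = finprod G c {..<n} \<otimes> r" for n
    using x(2) by (auto simp: bounds_products_def factor_def)
  then obtain r where r: "\<And>n. r n \<in> carrier G" "\<And>n. x = finprod G c {..<n} \<otimes> r n" by metis
  have rec: "r n = c n \<otimes> r (Suc n)" for n
  proof -
    have "finprod G c {..<Suc n} = c n \<otimes> finprod G c {..<n}"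
      using cl by (simp add: lessThan_Suc)
    hence "finprod G c {..<n} \<otimes> r n = finprod G c {..<n} \<otimes> (c n \<otimes> r (Suc n))"
      using r(2)[of n] r(2)[of "Suc n"] r(1) cl by (simp add: m_ac)
    thus ?thesis
      using l_cancel[of "finprod G c {..<n}" "r n" "c n \<otimes> r (Suc n)"] r(1) cl by simp
  qed
  have r1: "r n \<noteq> \<one>" for n
  proof
    assume "r n = \<one>"
    hence "x = finprod G c {..<n}" using r(2)[of n] cl by simp
    moreover have "finprod G c {..<n} \<in> submonoid_span G (range c)"
      using submonoid_submonoid_span[OF c(1)] submonoid_span_base[OF c(1)]
      by (intro finprod_mem_submonoid) auto
    ultimately show False using not by simp
  qed
  define A where "A = range c \<union> range r"
  have A: "A \<subseteq> carrier G" using c r by (auto simp: A_def)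
  note H = submonoid_submonoid_span[OF A]
  have "x = r 0" using r(2)[of 0] r(1) by simp
  hence "x \<in> submonoid_span G A" using submonoid_span_base[OF A] by (auto simp: A_def)
  hence "x \<in> submonoid_span G {a. atom (G\<lparr>carrier := submonoid_span G A\<rparr>) a}"
    using her H by (auto simp: hereditarily_atomic_def atomic_monoid_def
        atomic_element_submonoid_iff)
  moreover have "{a. atom (G\<lparr>carrier := submonoid_span G A\<rparr>) a} \<subseteq> range c"
  proof clarify
    fix a assume a: "atom (G\<lparr>carrier := submonoid_span G A\<rparr>) a"
    have "a \<noteq> r n" for n
    proof
      assume "a = r n"
      moreover have "c n \<in> submonoid_span G A" "r (Suc n) \<in> submonoid_span G A"
        using submonoid_span_base[OF A] by (auto simp: A_def)
      ultimately show False
        using a c(2) r1 rec[of n] unfolding atom_submonoid_iff[OF H] by blast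
    qed
    thus "a \<in> range c" using atom_submonoid_span_mem_generators[OF A a] by (auto simp: A_def)
  qed
  ultimately show False using not submonoid_span_mono by metis
qed

text \<open>The case of a constant sequence: \<open>x = a [^] m\<close> would be divisible by \<open>a [^] (m + 1)\<close>.\<close>

lemma powers_dividing_bounded:
  assumes her: "hereditarily_atomic G" and a: "a \<in> carrier G" "a \<noteq> \<one>" and x: "x \<in> carrier G"
  shows "finite {k::nat. a [^] k divides x}"
proof (rule ccontr)
  assume inf: "infinite {k::nat. a [^] k divides x}"
  have all: "a [^] n divides x" for n :: nat
  proof -
    obtain k where k: "k \<ge> n" "a [^] k divides x"
      using inf unfolding infinite_nat_iff_unbounded_le by blast
    have "a [^] k = a [^] n \<otimes> a [^] (k - n)" using k a by (simp add: nat_pow_mult)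
    hence "a [^] n divides a [^] k" using a by (auto simp: factor_def)
    thus ?thesis using k a x by (meson divides_trans nat_pow_closed)
  qed
  have "x \<in> submonoid_span G (range (\<lambda>_::nat. a))"
    using all a x by (intro bounded_products_imp_mem_span her)
      (auto simp: bounds_products_def finprod_const)
  hence "\<exists>m::nat. x = a [^] m"
  proof induction
    case one
    show ?case by (intro exI[of _ 0]) simp
  next
    case (mult g z)
    then obtain m where "z = a [^] (m::nat)" by blast
    thus ?case using mult a by (intro exI[of _ "Suc m"]) (auto simp: m_comm)
  qed
  then obtain m where m: "x = a [^] (m::nat)" by blast
  obtain d where d: "d \<in> carrier G" "x = a [^] Suc m \<otimes> d"
    using all[of "Suc m"] by (auto simp: factor_def)
  have "a [^] m \<otimes> (a \<otimes> d) = a [^] m" using d m a by (simp add: m_assoc)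
  hence "a \<otimes> d = \<one>" using mult_eq_left_imp[of "a [^] m" "a \<otimes> d"] a d by simp
  thus False using mult_eq_one_imp(1)[of a d] a d by simp
qed

text \<open>A value attained \<open>n\<close> times contributes its \<open>n\<close>-th power to the products dividing \<open>x\<close>.\<close>

lemma value_repetitions_bounded:
  assumes her: "hereditarily_atomic G" and c: "range c \<subseteq> carrier G" "a \<noteq> \<one>"
    and x: "x \<in> carrier G" "bounds_products x c"
  shows "finite {j. c j = a}"
proof (rule ccontr)
  assume inf: "infinite {j. c j = a}"
  hence a: "a \<in> carrier G" using c not_finite_existsD by blast
  have "a [^] n divides x" for n :: nat
  proof -
    obtain F where F: "finite F" "card F = n" "F \<subseteq> {j. c j = a}"
      using infinite_arbitrarily_large[OF inf] by blast
    have "finprod G c F = finprod G (\<lambda>_. a) F"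
      using F a by (intro finprod_cong') auto
    also have "\<dots> = a [^] n" using a F by (simp add: finprod_const)
    finally show ?thesis using x F by (metis bounds_products_def)
  qed
  thus False using powers_dividing_bounded[OF her a c(2) x(1)] by simp
qed

section \<open>A common power of infinitely many factors\<close>

text \<open>If \<open>R\<close> consists of the elements that complete some product to \<open>x\<close>, then \<open>cofactors R a\<close>
  consists of those that complete such a product to \<open>x\<close> once a power of \<open>a\<close> is added to it.\<close>

definition cofactors :: "'a set \<Rightarrow> 'a \<Rightarrow> 'a set" where
  "cofactors R a = {y \<in> carrier G. \<exists>k::nat. y \<otimes> a [^] k \<in> R}"

lemma finite_cofactors:
  assumes "hereditarily_atomic G" "finite R" "R \<subseteq> carrier G" "a \<in> carrier G" "a \<noteq> \<one>"
  shows "finite (cofactors R a)"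
proof -
  have "cofactors R a \<subseteq> (\<Union>z\<in>R. \<Union>k\<in>{k::nat. a [^] k divides z}. {y \<in> carrier G. y \<otimes> a [^] k = z})"
  proof
    fix y assume "y \<in> cofactors R a"
    then obtain k where k: "y \<in> carrier G" "y \<otimes> a [^] (k::nat) \<in> R" by (auto simp: cofactors_def)
    have "a [^] k divides (y \<otimes> a [^] k)"
      using k assms(4) m_comm[of y "a [^] k"] by (auto simp: factor_def)
    thus "y \<in> (\<Union>z\<in>R. \<Union>k\<in>{k::nat. a [^] k divides z}. {y \<in> carrier G. y \<otimes> a [^] k = z})"
      using k by blast
  qed
  moreover have "finite {y \<in> carrier G. y \<otimes> a [^] k = z}" for k :: nat and z
  proof -
    have "u = v" if "u \<in> carrier G" "u \<otimes> a [^] k = z" "v \<in> carrier G" "v \<otimes> a [^] k = z" for u v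
      using that assms(4) r_cancel[of u "a [^] k" v] by simp
    hence "{y \<in> carrier G. y \<otimes> a [^] k = z} \<subseteq> {u}"
      if "u \<in> carrier G" "u \<otimes> a [^] k = z" for u
      using that by blast
    thus ?thesis
      by (cases "{y \<in> carrier G. y \<otimes> a [^] k = z} = {}") (auto intro: finite_subset)
  qed
  ultimately show ?thesis
    using assms powers_dividing_bounded by (elim finite_subset) blast
qed

text \<open>Suppose that each \<open>y \<noteq> \<one>\<close> is a power of only finitely many \<open>c j\<close>. A subsequence is chosen
  one index at a time, keeping track of the finite set \<open>R\<close> of cofactors in \<open>x\<close> of products of the
  elements chosen so far. As long as \<open>\<one> \<notin> R\<close>, the next index can avoid the finitely many \<open>j\<close>
  with a power of \<open>c j\<close> in \<open>R\<close>, which keeps \<open>\<one>\<close> out of the new set of cofactors. So \<open>x\<close> is never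
  a product of chosen elements, although it still bounds their products.\<close>

lemma exists_common_power:
  assumes her: "hereditarily_atomic G" and c: "range c \<subseteq> carrier G" "\<And>i. c i \<noteq> \<one>"
    and x: "x \<in> carrier G" "bounds_products x c"
  shows "\<exists>y\<in>carrier G. y \<noteq> \<one> \<and> infinite {j. \<exists>k::nat. c j [^] k = y}"
proof (rule ccontr)
  assume "\<not> ?thesis"
  hence fin: "finite {j. \<exists>k::nat. c j [^] k = y}" if "y \<in> carrier G" "y \<noteq> \<one>" for y
    using that by blast
  have cl: "c i \<in> carrier G" for i using c by auto
  have x1: "x \<noteq> \<one>"
  proof
    assume "x = \<one>"
    moreover have "finprod G c {0} divides x" using x by (simp add: bounds_products_def)
    moreover have "finprod G c {0} = c 0" using cl finprod_insert[of "{}" 0 c] by simp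
    ultimately obtain d where "d \<in> carrier G" "c 0 \<otimes> d = \<one>" by (auto simp: factor_def)
    thus False using mult_eq_one_imp(1)[of "c 0" d] cl c(2) by simp
  qed
  \<comment> \<open>A state is the current set of cofactors with the index chosen last; in the initial state
    nothing has been chosen and the index is arbitrary.\<close>
  define P where "P = (\<lambda>n::nat. \<lambda>(R, j::nat). finite R \<and> R \<subseteq> carrier G \<and> \<one> \<notin> R \<and> (n = 0 \<longrightarrow> R = {x}))"
  define Q where "Q = (\<lambda>n::nat. \<lambda>(R, j) (R', j'). j < j' \<and> R' = cofactors R (c j'))"
  have "\<exists>f. \<forall>n. P n (f n) \<and> Q n (f n) (f (Suc n))"
  proof (rule dependent_nat_choice)
    show "\<exists>s. P 0 s" using x x1 by (auto simp: P_def)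
  next
    fix s n assume "P n s"
    then obtain R j where s: "s = (R, j)" "finite R" "R \<subseteq> carrier G" "\<one> \<notin> R"
      by (cases s) (auto simp: P_def)
    have "finite (\<Union>y\<in>R. {j. \<exists>k::nat. c j [^] k = y})"
      using s fin by (intro finite_UN_I) (auto dest: subsetD)
    hence "finite ({..j} \<union> (\<Union>y\<in>R. {j. \<exists>k::nat. c j [^] k = y}))" by simp
    then obtain j' where j': "j' \<notin> {..j} \<union> (\<Union>y\<in>R. {j. \<exists>k::nat. c j [^] k = y})"
      using ex_new_if_finite[OF infinite_UNIV_nat] by blast
    have "\<one> \<notin> cofactors R (c j')"
      using j' cl by (auto simp: cofactors_def)
    moreover have "finite (cofactors R (c j'))"
      using s cl c her by (intro finite_cofactors) auto
    moreover have "cofactors R (c j') \<subseteq> carrier G" by (auto simp: cofactors_def)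
    ultimately show "\<exists>t. P (Suc n) t \<and> Q n s t"
      using j' by (intro exI[of _ "(cofactors R (c j'), j')"]) (auto simp: P_def Q_def s)
  qed
  then obtain f where f: "\<And>n. P n (f n)" "\<And>n. Q n (f n) (f (Suc n))" by blast
  define R where "R = (\<lambda>n. fst (f n))"
  define j where "j = (\<lambda>n. snd (f (Suc n)))"
  have R0: "R 0 = {x}" and R1: "\<And>n. \<one> \<notin> R n"
    using f(1) by (auto simp: R_def P_def split_beta)
  have Rs: "R (Suc n) = cofactors (R n) (c (j n))" for n
    using f(2)[of n] by (auto simp: R_def j_def Q_def split_beta)
  have "strict_mono j"
    using f(2) by (auto simp: strict_mono_Suc_iff j_def Q_def split_beta)
  hence "bounds_products x (c \<circ> j)"
    using x c by (intro bounds_products_subsequence) (auto intro: strict_mono_imp_inj_on)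
  hence "x \<in> submonoid_span G (range (c \<circ> j))"
    using c x by (intro bounded_products_imp_mem_span her) auto
  hence "\<exists>n. x \<in> submonoid_span G ((c \<circ> j) ` {..<n})"
  proof induction
    case (mult a z)
    then obtain n i where "z \<in> submonoid_span G ((c \<circ> j) ` {..<n})" "a = (c \<circ> j) i" by blast
    moreover have "(c \<circ> j) ` {..<n} \<subseteq> (c \<circ> j) ` {..<max n (Suc i)}" by (intro image_mono) auto
    moreover have "(c \<circ> j) i \<in> (c \<circ> j) ` {..<max n (Suc i)}" by (intro imageI) auto
    ultimately show ?case using submonoid_span_mono submonoid_span.mult by metis
  qed (auto intro: submonoid_span.one)
  then obtain n where "x \<in> submonoid_span G ((c \<circ> j) ` {..<n})" by blast
  \<comment> \<open>\<open>R n\<close> contains all cofactors in \<open>x\<close> of products of the first \<open>n\<close> chosen elements.\<close>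
  moreover have "y \<in> R n"
    if "w \<in> submonoid_span G ((c \<circ> j) ` {..<n})" "y \<in> carrier G" "y \<otimes> w = x" for n y w
    using that
  proof (induction n arbitrary: y w)
    case 0
    have "w = \<one>" using 0(1) by (auto elim: submonoid_span.cases)
    thus ?case using 0 R0 by simp
  next
    case (Suc n)
    have sub: "(c \<circ> j) ` {..<n} \<subseteq> carrier G" using cl by auto
    obtain k w' where w': "w' \<in> submonoid_span G ((c \<circ> j) ` {..<n})" "w = c (j n) [^] (k::nat) \<otimes> w'"
      using submonoid_span_insert_decompose[OF _ cl sub, of w "j n"] Suc.prems(1)
      by (auto simp: lessThan_Suc)
    have "w' \<in> carrier G" using w' sub submonoid_span_carrier by blast
    hence "y \<otimes> c (j n) [^] k \<in> R n"
      using Suc.prems cl w' by (intro Suc.IH[of w']) (auto simp: m_assoc)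
    thus ?case using Suc.prems by (auto simp: Rs cofactors_def)
  qed
  ultimately show False using R1 x by (metis l_one one_closed)
qed

section \<open>Roots with exponents coprime to a modulus\<close>

text \<open>Additively, \<open>c j = y / (d * u j)\<close>, and adding these fractions over \<open>F\<close> gives \<open>t y / (d U)\<close>
  with \<open>U\<close> the product of the \<open>u j\<close> and \<open>t\<close> the sum of the quotients \<open>U / u j\<close>. Each quotient
  times \<open>\<rho>\<close> is congruent to \<open>U\<close>, whence the congruence for \<open>t\<close>; for \<open>card F = q\<close> it makes \<open>t\<close>
  divisible by \<open>q\<close>.\<close>

lemma powers_of_products_of_roots:
  assumes y: "y \<in> carrier G" and c: "range c \<subseteq> carrier G"
    and F: "finite F" "\<And>j. j \<in> F \<Longrightarrow> c j [^] (d * u j :: nat) = y"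
    and u: "\<And>j. j \<in> F \<Longrightarrow> coprime (u j) q" "\<And>j. j \<in> F \<Longrightarrow> [u j = \<rho>] (mod q)"
  shows "\<exists>U t. coprime U q \<and> finprod G c F [^] (d * U) = y [^] t \<and> [t * \<rho> = card F * U] (mod q)"
  using F u
proof (induction F rule: finite_induct)
  case empty
  show ?case by (intro exI[of _ 1] exI[of _ 0]) simp
next
  case (insert j F)
  then obtain U t where U: "coprime U q" "finprod G c F [^] (d * U) = y [^] t"
      "[t * \<rho> = card F * U] (mod q)"
    by auto
  have cl: "c i \<in> carrier G" for i using c by auto
  have "finprod G c (insert j F) [^] (d * (u j * U))
      = c j [^] (d * u j * U) \<otimes> finprod G c F [^] (d * U * u j)"
    using insert.hyps cl by (simp add: nat_pow_distrib mult_ac)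
  also have "c j [^] (d * u j * U) = y [^] U"
    using insert.prems(1)[of j] cl by (simp flip: nat_pow_pow)
  also have "finprod G c F [^] (d * U * u j) = y [^] (t * u j)"
    using U(2) cl y by (simp flip: nat_pow_pow)
  finally have pow: "finprod G c (insert j F) [^] (d * (u j * U)) = y [^] (U + t * u j)"
    using y by (simp add: nat_pow_mult)
  have "[U * \<rho> + t * \<rho> * u j = U * u j + card F * U * u j] (mod q)"
    using insert.prems(3)[of j]
    by (intro cong_add cong_scalar_left cong_scalar_right[OF U(3)]) (auto intro: cong_sym)
  hence "[(U + t * u j) * \<rho> = card (insert j F) * (u j * U)] (mod q)"
    using insert.hyps by (simp add: algebra_simps)
  moreover have "coprime (u j * U) q" using insert.prems(2)[of j] U(1) by simp
  ultimately show ?case using pow by blast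
qed

text \<open>Additively, these are the elements of the form \<open>q t y / (d U)\<close> with \<open>U\<close> coprime to \<open>q\<close>: the
  multiples of \<open>q\<close> in the localisation at \<open>q\<close> of the multiples of \<open>y / d\<close>.\<close>

definition fractions_divisible_by :: "nat \<Rightarrow> nat \<Rightarrow> 'a \<Rightarrow> 'a set" where
  "fractions_divisible_by q d y =
     {w \<in> carrier G. \<exists>U t. coprime U q \<and> w [^] (d * U) = y [^] (q * t)}"

lemma submonoid_fractions:
  assumes "y \<in> carrier G"
  shows "submonoid (fractions_divisible_by q d y) G"
proof
  have "coprime 1 q \<and> \<one> [^] (d * 1) = y [^] (q * 0)" by simp
  thus "\<one> \<in> fractions_divisible_by q d y"
    unfolding fractions_divisible_by_def by blast
next
  fix v w assume "v \<in> fractions_divisible_by q d y" "w \<in> fractions_divisible_by q d y"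
  then obtain U t U' t' where v: "v \<in> carrier G" "coprime U q" "v [^] (d * U) = y [^] (q * t)"
    and w: "w \<in> carrier G" "coprime U' q" "w [^] (d * U') = y [^] (q * t')"
    by (auto simp: fractions_divisible_by_def)
  have "(v \<otimes> w) [^] (d * (U * U')) = v [^] (d * U * U') \<otimes> w [^] (d * U' * U)"
    using v w by (simp add: nat_pow_distrib mult_ac)
  also have "v [^] (d * U * U') = y [^] (q * t * U')"
    using v assms by (simp flip: nat_pow_pow)
  also have "w [^] (d * U' * U) = y [^] (q * t' * U)"
    using w assms by (simp flip: nat_pow_pow)
  finally have "(v \<otimes> w) [^] (d * (U * U')) = y [^] (q * (t * U' + t' * U))"
    using assms by (simp add: nat_pow_mult algebra_simps)
  moreover have "coprime (U * U') q" using v w by simp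
  ultimately show "v \<otimes> w \<in> fractions_divisible_by q d y"
    using v(1) w(1) m_closed unfolding fractions_divisible_by_def by blast
qed (auto simp: fractions_divisible_by_def)

text \<open>The difference \<open>y / (d u)\<close> of the two elements would be of the form \<open>q t y / (d U)\<close>, although
  its numerator is coprime to \<open>q\<close>. Comparing exponents of \<open>y\<close> turns this into a divisibility of
  \<open>U * U'\<close> by \<open>q\<close>.\<close>

lemma not_both_fractions:
  assumes y: "y \<in> carrier G" "y \<noteq> \<one>" and q: "q > 1"
    and a: "a \<in> carrier G" "a [^] (d * u) = y" "coprime u q"
    and x: "x \<in> fractions_divisible_by q d y"
  shows "x \<otimes> a \<notin> fractions_divisible_by q d y"
proof
  assume "x \<otimes> a \<in> fractions_divisible_by q d y"
  then obtain U t U' t' where x: "x \<in> carrier G" "coprime U q" "x [^] (d * U) = y [^] (q * t)"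
    and xa: "coprime U' q" "(x \<otimes> a) [^] (d * U') = y [^] (q * t')"
    using x by (auto simp: fractions_divisible_by_def)
  have "y [^] (q * t' * (U * u)) = (x \<otimes> a) [^] (d * U' * (U * u))"
    using x a y xa by (simp flip: nat_pow_pow)
  also have "\<dots> = x [^] (d * U * (U' * u)) \<otimes> a [^] (d * u * (U * U'))"
    using x a by (simp add: nat_pow_distrib mult_ac)
  also have "x [^] (d * U * (U' * u)) = y [^] (q * t * (U' * u))"
    using x y by (simp flip: nat_pow_pow)
  also have "a [^] (d * u * (U * U')) = y [^] (U * U')"
    using a by (simp flip: nat_pow_pow)
  finally have "y [^] (q * t' * (U * u)) = y [^] (q * t * (U' * u) + U * U')"
    using y by (simp add: nat_pow_mult)
  hence "q * t' * (U * u) = q * t * (U' * u) + U * U'" using pow_inject_exp y by blast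
  hence "q dvd q * t * (U' * u) + U * U'" by (metis dvd_triv_left mult.assoc)
  hence "q dvd U * U'" by (metis dvd_add_right_iff dvd_triv_left mult.assoc)
  moreover have "coprime (U * U') q" using x xa by simp
  ultimately show False using q by (metis coprime_absorb_right dvd_refl coprime_common_divisor_nat nat_neq_iff)
qed

text \<open>Blocks of \<open>q\<close> roots lie in \<open>fractions_divisible_by q d y\<close>, and hence so does every element
  that bounds the products of the \<open>c i\<close>. Both \<open>x\<close> and \<open>x \<otimes> c j\<close> are such elements.\<close>

lemma no_coprime_roots:
  assumes her: "hereditarily_atomic G" and c: "range c \<subseteq> carrier G" "\<And>i. c i \<noteq> \<one>"
    and x: "x \<in> carrier G" "bounds_products x c"
    and y: "y \<in> carrier G" "y \<noteq> \<one>" and q: "(q::nat) > 1" and S: "infinite S"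
    and root: "\<And>j. j \<in> S \<Longrightarrow> c j [^] (d * u j) = y"
    and u: "\<And>j. j \<in> S \<Longrightarrow> coprime (u j) q" "\<And>j. j \<in> S \<Longrightarrow> [u j = \<rho>] (mod q)"
  shows False
proof -
  let ?P = "fractions_divisible_by q d y"
  have cl: "c i \<in> carrier G" for i using c by auto
  define f where "f = enumerate S"
  have f: "f i \<in> S" for i by (simp add: f_def enumerate_in_set S)
  have inj: "inj f" using strict_mono_enumerate[OF S] by (simp add: f_def strict_mono_imp_inj_on)
  define B where "B = (\<lambda>i. f ` {q * i..<q * i + q})"
  have B: "finite (B i)" "card (B i) = q" "B i \<subseteq> S" for i
    using f inj by (auto simp: B_def card_image inj_on_subset[OF inj])
  have disj: "disjoint_family B"
  proof -
    have "i = i'" if "k \<in> {q * i..<q * i + q}" "k \<in> {q * i'..<q * i' + q}" for i i' k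
    proof -
      have "k div q = i" "k div q = i'"
        using that by (auto intro!: div_nat_eqI simp: mult_ac)
      thus ?thesis by simp
    qed
    hence "{q * i..<q * i + q} \<inter> {q * i'..<q * i' + q} = {}" if "i \<noteq> i'" for i i'
      using that by blast
    thus ?thesis
      by (simp add: disjoint_family_on_def B_def flip: image_Int[OF inj])
  qed
  define c' where "c' = (\<lambda>i. finprod G c (B i))"
  have "coprime \<rho> q"
    using u[OF f] by (metis cong_imp_coprime)
  have c': "c' i \<in> ?P" for i
  proof -
    obtain U t where U: "coprime U q" "c' i [^] (d * U) = y [^] t" "[t * \<rho> = q * U] (mod q)"
      using powers_of_products_of_roots[OF y(1) c(1) B(1)[of i], of d u q \<rho>] root u B
      unfolding c'_def by (metis subsetD)
    have "[t * \<rho> = 0] (mod q)" using U(3) by (simp add: cong_def)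
    hence "q dvd t"
      using \<open>coprime \<rho> q\<close> by (simp add: cong_0_iff coprime_commute coprime_dvd_mult_left_iff)
    thus ?thesis
      using U cl by (auto simp: fractions_divisible_by_def c'_def elim!: dvdE)
  qed
  have c'1: "c' i \<noteq> \<one>" for i
  proof -
    have "f (q * i) \<in> B i" using q by (auto simp: B_def)
    thus ?thesis
      using finprod_eq_one_imp[OF _ B(1) _ c(1)] c(2) by (auto simp: c'_def)
  qed
  have bound: "z \<in> ?P" if z: "z \<in> carrier G" "bounds_products z c" for z
  proof -
    have "bounds_products z c'"
      unfolding c'_def using z c B disj by (intro bounds_products_blocks) auto
    hence "z \<in> submonoid_span G (range c')"
      using her z c'1 cl by (intro bounded_products_imp_mem_span) (auto simp: c'_def)
    thus ?thesis
      using submonoid_span_subset[OF _ submonoid_fractions[OF y(1)]] c' by blast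
  qed
  have "x \<otimes> c (f 0) \<in> ?P"
    using x c cl by (intro bound bounds_products_mult) auto
  thus False
    using not_both_fractions[OF y q cl root[OF f] u(1)[OF f] bound[OF x]] by blast
qed

section \<open>Hereditary atomicity implies the chain condition\<close>

text \<open>The roots \<open>c j\<close> of the common power \<open>y\<close> either generate a submonoid without atoms, when their
  exponents have no maximal element for divisibility, or they contain infinitely many roots whose
  exponents are coprime to a common modulus up to a common factor.\<close>

lemma hereditarily_atomic_no_bounds:
  assumes her: "hereditarily_atomic G" and tf: "torsion_free_monoid G"
    and c: "range c \<subseteq> carrier G" "\<And>i. c i \<noteq> \<one>"
    and x: "x \<in> carrier G" "bounds_products x c"
  shows False
proof -
  have cl: "c i \<in> carrier G" for i using c by auto
  obtain y where y: "y \<in> carrier G" "y \<noteq> \<one>" and inf: "infinite {j. \<exists>k::nat. c j [^] k = y}"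
    using exists_common_power[OF her c x] by blast
  define S where "S = {j. \<exists>k::nat. c j [^] k = y}"
  have S: "infinite S" using inf by (simp add: S_def)
  have "\<exists>k::nat. c j [^] k = y" if "j \<in> S" for j using that by (simp add: S_def)
  then obtain k :: "nat \<Rightarrow> nat" where k: "\<And>j. j \<in> S \<Longrightarrow> c j [^] k j = y" by metis
  have k0: "k j > 0" if "j \<in> S" for j
    using k[OF that] y by (cases "k j") auto
  show False
  proof (cases "\<forall>j\<in>S. \<exists>j'\<in>S. k j dvd k j' \<and> k j \<noteq> k j'")
    case True
    define A where "A = c ` S"
    have A: "A \<subseteq> carrier G" using c by (auto simp: A_def)
    note H = submonoid_submonoid_span[OF A]
    have noatom: "\<not> atom (G\<lparr>carrier := submonoid_span G A\<rparr>) a" for a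
    proof
      assume a: "atom (G\<lparr>carrier := submonoid_span G A\<rparr>) a"
      then obtain j where j: "j \<in> S" "a = c j"
        using atom_submonoid_span_mem_generators[OF A] by (auto simp: A_def)
      obtain j' m where j': "j' \<in> S" "k j' = k j * m" "k j \<noteq> k j'"
        using True j by (auto elim!: dvdE)
      have m: "m > 1" using j'(2,3) k0[OF j'(1)] by (cases m) auto
      have "(c j' [^] m) [^] k j = c j [^] k j"
        using k[OF j(1)] k[OF j'(1)] j'(2) cl by (simp add: nat_pow_pow mult.commute)
      hence "c j' [^] m = a"
        using torsion_free_pow_inject[OF tf _ _ k0[OF j(1)]] cl j by auto
      hence fact: "a = c j' [^] (m - 1) \<otimes> c j'"
        using m nat_pow_Suc[of "c j'" "m - 1"] by simp
      have base: "c j' \<in> submonoid_span G A"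
        using j' submonoid_span_base[OF A] by (auto simp: A_def)
      have pow: "c j' [^] n \<in> submonoid_span G A" for n :: nat
        by (induction n) (auto intro: submonoid_span.one submonoid_span_mult_closed[OF A] base)
      have "v = \<one> \<or> w = \<one>"
        if "v \<in> submonoid_span G A" "w \<in> submonoid_span G A" "a = v \<otimes> w" for v w
        using a that by (simp add: atom_submonoid_iff[OF H])
      from this[OF pow base fact] have "c j' [^] (m - 1) = \<one>" using c(2) by simp
      thus False using pow_eq_one_imp[OF cl, of j' "m - 1"] c(2) m by simp
    qed
    obtain j where "j \<in> S" using S not_finite_existsD by (metis finite.emptyI equals0I)
    hence "c j \<in> submonoid_span G A" using submonoid_span_base[OF A] by (auto simp: A_def)
    hence "c j \<in> submonoid_span G {a. atom (G\<lparr>carrier := submonoid_span G A\<rparr>) a}"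
      using her H by (auto simp: hereditarily_atomic_def atomic_monoid_def
          atomic_element_submonoid_iff)
    hence "c j = \<one>" using noatom by (auto elim: submonoid_span.cases)
    thus False using c by blast
  next
    case False
    then obtain j0 where j0: "j0 \<in> S" "\<And>j. j \<in> S \<Longrightarrow> k j0 dvd k j \<Longrightarrow> k j = k j0" by metis
    define n where "n = k j0"
    have n: "n > 0" using k0 j0 by (simp add: n_def)
    have "{j \<in> S. k j = n} \<subseteq> {j. c j = c j0}"
      using torsion_free_pow_inject[OF tf cl cl n] k j0 by (auto simp: n_def) metis
    hence "finite {j \<in> S. k j = n}"
      using value_repetitions_bounded[OF her c(1) c(2) x] finite_subset by blast
    moreover have "S = {j \<in> S. k j = n} \<union> {j \<in> S. k j \<noteq> n}" by blast
    ultimately have inf': "infinite {j \<in> S. k j \<noteq> n}" using S by (metis finite_Un)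
    \<comment> \<open>The second component is reduced modulo \<open>n\<close>, a multiple of the eventual modulus
      \<open>q = n div d\<close>, because \<open>d\<close> is only known after the pigeonhole step.\<close>
    define g where "g = (\<lambda>j. (gcd (k j) n, k j div gcd (k j) n mod n))"
    have "g ` {j \<in> S. k j \<noteq> n} \<subseteq> {..n} \<times> {..<n}" using n by (auto simp: g_def)
    hence "finite (g ` {j \<in> S. k j \<noteq> n})" by (rule finite_subset) auto
    from pigeonhole_infinite[OF inf' this] obtain i where
      i: "i \<in> S" "k i \<noteq> n" "infinite {j \<in> {j \<in> S. k j \<noteq> n}. g j = g i}" by blast
    define T where "T = {j \<in> {j \<in> S. k j \<noteq> n}. g j = g i}"
    define d where "d = gcd (k i) n"
    define q where "q = n div d"
    have d: "d dvd n" "d > 0" "n = d * q" using n by (auto simp: d_def q_def)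
    have T: "j \<in> S" "gcd (k j) n = d" "[k j div d = k i div d] (mod q)" if "j \<in> T" for j
    proof -
      show "j \<in> S" "gcd (k j) n = d" using that by (auto simp: T_def g_def d_def)
      have "[k j div d = k i div d] (mod n)" using that by (auto simp: T_def g_def d_def cong_def)
      thus "[k j div d = k i div d] (mod q)" using d(3) by (metis cong_dvd_modulus_nat dvd_triv_right)
    qed
    have "q \<noteq> 1"
    proof
      assume "q = 1"
      hence "n dvd k i" using d by (metis d_def gcd_dvd1 mult.right_neutral)
      thus False using j0(2)[OF i(1)] i(2) by (simp add: n_def)
    qed
    hence q: "q > 1" using n d by (cases q) auto
    show False
    proof (rule no_coprime_roots[OF her c x y q])
      show "infinite T" using i by (simp add: T_def)
      fix j assume j: "j \<in> T"
      have "d dvd k j" using T(2)[OF j] by (metis gcd_dvd1)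
      thus "c j [^] (d * (k j div d)) = y" using k T(1)[OF j] by simp
      show "coprime (k j div d) q"
        using div_gcd_coprime[of "k j" n] n T(2)[OF j] by (simp add: q_def)
      show "[k j div d = k i div d] (mod q)" using T(3)[OF j] .
    qed
  qed
qed

text \<open>The non-trivial quotients of consecutive elements of a chain that does not stabilise form an
  infinite sequence whose products are bounded by the first element of the chain.\<close>

lemma hereditarily_atomic_imp_ACCP:
  assumes her: "hereditarily_atomic G" and tf: "torsion_free_monoid G"
  shows "ACCP G"
  unfolding ACCP_def
proof (intro allI impI, elim conjE)
  fix b :: "nat \<Rightarrow> 'a"
  assume b: "\<forall>n. b n \<in> carrier G"
    and asc: "\<forall>n. principal_ideal_of G (b n) \<subseteq> principal_ideal_of G (b (Suc n))"
  have "\<exists>d. d \<in> carrier G \<and> b n = b (Suc n) \<otimes> d" for n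
  proof -
    have "b n \<in> principal_ideal_of G (b n)"
      using b by (auto simp: principal_ideal_of_def intro!: exI[of _ "\<one>"])
    thus ?thesis using asc by (auto simp: principal_ideal_of_def)
  qed
  then obtain d where d: "\<And>n. d n \<in> carrier G" "\<And>n. b n = b (Suc n) \<otimes> d n" by metis
  show "\<exists>n0. \<forall>n\<ge>n0. principal_ideal_of G (b n) = principal_ideal_of G (b (Suc n))"
  proof (rule ccontr)
    assume not: "\<not> ?thesis"
    have "\<exists>n\<ge>m. d n \<noteq> \<one>" for m
    proof -
      obtain n where "n \<ge> m" "principal_ideal_of G (b n) \<noteq> principal_ideal_of G (b (Suc n))"
        using not by blast
      moreover have "b n = b (Suc n)" if "d n = \<one>"
        using d(2)[of n] b that by simp
      ultimately show ?thesis by auto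
    qed
    hence inf: "infinite {n. d n \<noteq> \<one>}" by (auto simp: infinite_nat_iff_unbounded_le)
    have telescope: "b 0 = finprod G d {..<n} \<otimes> b n" for n
    proof (induction n)
      case 0
      show ?case using b by simp
    next
      case (Suc n)
      have "finprod G d {..<Suc n} = d n \<otimes> finprod G d {..<n}"
        using d(1) by (simp add: lessThan_Suc)
      thus ?case using Suc b d(1) d(2)[of n] by (simp add: m_ac)
    qed
    have "bounds_products (b 0) d"
      unfolding bounds_products_def
    proof (intro allI impI)
      fix F :: "nat set" assume "finite F"
      then obtain n where n: "F \<subseteq> {..<n}" using finite_nat_iff_bounded by blast
      have "finprod G d (F \<union> ({..<n} - F)) = finprod G d F \<otimes> finprod G d ({..<n} - F)"
        using d(1) \<open>finite F\<close> by (intro finprod_Un_disjoint) auto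
      moreover have "F \<union> ({..<n} - F) = {..<n}" using n by blast
      ultimately have "b 0 = finprod G d F \<otimes> (finprod G d ({..<n} - F) \<otimes> b n)"
        using telescope[of n] d(1) b by (simp add: m_assoc)
      thus "finprod G d F divides b 0" using d(1) b by (auto simp: factor_def)
    qed
    moreover define f where "f = enumerate {n. d n \<noteq> \<one>}"
    moreover have "inj f" using strict_mono_enumerate[OF inf] by (simp add: f_def strict_mono_imp_inj_on)
    ultimately have "bounds_products (b 0) (d \<circ> f)"
      using d(1) by (intro bounds_products_subsequence) auto
    moreover have "(d \<circ> f) i \<noteq> \<one>" for i
      using enumerate_in_set[OF inf, of i] by (simp add: f_def)
    ultimately show False
      using hereditarily_atomic_no_bounds[OF her tf, of "d \<circ> f" "b 0"] d(1) b by auto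
  qed
qed

end

theorem theorem3p1:
  fixes M :: "('a, 'b) monoid_scheme"
  assumes "comm_monoid_cancel M"
    and "reduced_monoid M"
    and "torsion_free_monoid M"
  shows "ACCP M \<longleftrightarrow> hereditarily_atomic M"
proof -
  interpret reduced_cancel_monoid M
    using assms(1,2) by (intro reduced_cancel_monoid.intro reduced_cancel_monoid_axioms.intro)
  show ?thesis
    using ACCP_imp_hereditarily_atomic hereditarily_atomic_imp_ACCP assms(3) by blast
qed

end
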